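(* Let $A_{m,r}(\ell,b)$ be the recursively defined integers of the context. For all integers $m\ge 1$, $1\le\ell\le m$, $t\ge 0$ and $b\in\{1,3\}$, $$A_{m,\,b+4t}(\ell,b)=(-1)^{m-\ell}\binom{t}{m-\ell},$$ and $A_{m,r}(\ell,b)=0$ for every positive odd integer $r$ with $r\not\equiv b\pmod 4$. (Here $\binom{t}{m-\ell}=0$ when $t<m-\ell$.)
   Context: For $m\ge 1$, odd $r\ge 1$, $1\le\ell\le m$ and $b\in\{1,3\}$, the integers $A_{m,r}(\ell,b)$ are defined recursively as follows. (i) For $r\in\{1,3\}$: $A_{m,r}(\ell,b)=1$ if $\ell=m$ and $r=b$, and $A_{m,r}(\ell,b)=0$ otherwise. (ii) For odd $r\ge 5$: $A_{m,r}(\ell,b)=A_{m,r-4}(\ell,b)-A_{m-1,r-4}(\ell,b)$. Convention: $A_{m,r}(\ell,b)=0$ whenever $\ell>m$ (in particular $A_{0,r}(\ell,b)=0$ for all $\ell\ge 1$). *)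

theory Defs
  imports Complex_Main
begin

(* Acoef m r l b is the integer A_{m,r}(l,b).  The intended domain is r odd, l >= 1 and
   b in {1,3}; the value 0 for even r and for l = 0 is only a totalisation.  The condition
   m < l is the convention A_{m,r}(l,b) = 0 for l > m; it covers m = 0, so the truncated
   difference m - 1 is only evaluated for m >= 1. *)
function Acoef :: "nat \<Rightarrow> nat \<Rightarrow> nat \<Rightarrow> nat \<Rightarrow> int" where
  "Acoef m r l b =
    (if even r \<or> l = 0 \<or> m < l then 0
     else if r = 1 \<or> r = 3 then (if l = m \<and> r = b then 1 else 0)
     else Acoef m (r - 4) l b - Acoef (m - 1) (r - 4) l b)"
  by pat_completeness auto
termination
  by (relation "Wellfounded.measure (\<lambda>(m, r, l, b). r)") (auto elim: oddE)

declare Acoef.simps [simp del]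

lemma Acoef_base:
  assumes "1 \<le> l" "l \<le> m" "r \<in> {1, 3}"
  shows "Acoef m r l b = (if l = m \<and> r = b then 1 else 0)"
  using assms by (subst Acoef.simps) auto

lemma Acoef_rec:
  assumes "1 \<le> l" "l \<le> m" "odd r" "5 \<le> r"
  shows "Acoef m r l b = Acoef m (r - 4) l b - Acoef (m - 1) (r - 4) l b"
  using assms by (subst Acoef.simps) auto

lemma Acoef_convention: "m < l \<Longrightarrow> Acoef m r l b = 0"
  by (subst Acoef.simps) auto

end

theory Submission
  imports Defs
begin

text \<open>
  Each step \<open>r \<mapsto> r + 4\<close> applies the backward difference operator in \<open>m\<close>, so the sequence
  \<open>m \<mapsto> A\<^bsub>m,b+4t\<^esub>(l,b)\<close> is the \<open>t\<close>-fold backward difference of \<open>m \<mapsto> A\<^bsub>m,b\<^esub>(l,b)\<close>, the indicator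
  of \<open>m = l\<close>.  In terms of generating functions, the indicator \<open>x\<^sup>l\<close> is multiplied by
  \<open>(1 - x)\<^sup>t\<close>, whose coefficients are the signed binomials; on coefficients the induction is
  Pascal's rule (\<open>Acoef_same_class\<close>).  Since the step preserves the residue of \<open>r\<close> modulo 4, a
  class other than that of \<open>b\<close> starts from the zero sequence, and all differences of it vanish
  (\<open>Acoef_other_class\<close>).
\<close>

text \<open>
  For \<open>m < l\<close> all three terms vanish by convention.  Hence the difference equation holds for every
  \<open>m\<close>, which lets the inductions on \<open>t\<close> and \<open>r\<close> run over all \<open>m\<close> at once.
\<close>

lemma Acoef_add_4:
  assumes "1 \<le> l" "odd r"
  shows "Acoef m (r + 4) l b = Acoef m r l b - Acoef (m - 1) r l b"
proof (cases "m < l")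
  case True
  then show ?thesis by (simp add: Acoef_convention)
next
  case False
  moreover have "5 \<le> r + 4" using assms(2) by (cases r) auto
  ultimately show ?thesis using assms Acoef_rec[of l m "r + 4" b] by simp
qed

lemma Acoef_same_class:
  assumes l: "1 \<le> l" and b: "b \<in> {1, 3}"
  shows "Acoef (l + k) (b + 4 * t) l b = (-1) ^ k * int (t choose k)"
proof (induction t arbitrary: k)
  case 0
  then show ?case using l b by (cases k) (auto simp: Acoef_base)
next
  case (Suc t)
  have "odd (b + 4 * t)" using b by auto
  then have step: "Acoef (l + k) (b + 4 * Suc t) l b
      = Acoef (l + k) (b + 4 * t) l b - Acoef (l + k - 1) (b + 4 * t) l b"
    using Acoef_add_4[OF l, of "b + 4 * t" "l + k" b] by (simp add: ac_simps)
  show ?case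
  proof (cases k)
    case 0
    have "Acoef (l - 1) (b + 4 * t) l b = 0" using l by (simp add: Acoef_convention)
    then show ?thesis using step Suc.IH[of 0] 0 by simp
  next
    case (Suc j)
    then show ?thesis
      using step Suc.IH[of j] Suc.IH[of "Suc j"] by (simp add: algebra_simps)
  qed
qed

lemma Acoef_other_class:
  assumes l: "1 \<le> l" and "odd r" "r mod 4 \<noteq> b mod 4"
  shows "Acoef m r l b = 0"
  using assms(2,3)
proof (induction r arbitrary: m rule: less_induct)
  case (less r)
  show ?case
  proof (cases "r < 5")
    case True
    with less.prems(1) have "r \<in> {1, 3}"
      by (auto elim!: oddE)
    moreover have "r \<noteq> b" using less.prems(2) by auto
    ultimately show ?thesis
      using l by (cases "m < l") (auto simp: Acoef_convention Acoef_base)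
  next
    case False
    define s where "s = r - 4"
    have r: "r = s + 4" using False by (simp add: s_def)
    have "odd s" "s mod 4 \<noteq> b mod 4" using less.prems r by auto
    then show ?thesis using less.IH[of s] Acoef_add_4[OF l, of s m b] r by simp
  qed
qed

theorem lemma8p9:
  fixes m l b :: nat
  assumes "1 \<le> m" and "1 \<le> l" and "l \<le> m" and "b \<in> {1, 3}"
  shows "(\<forall>t::nat. Acoef m (b + 4 * t) l b = (-1) ^ (m - l) * int (t choose (m - l))) \<and>
    (\<forall>r::nat. odd r \<and> r mod 4 \<noteq> b mod 4 \<longrightarrow> Acoef m r l b = 0)"
  using Acoef_same_class[OF assms(2,4), of "m - l"] Acoef_other_class[OF assms(2)] assms(3)
  by auto

end
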